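(* (i) For every finite multiset $\Gamma$ of formulas and every formula $\varphi$: $\vdash_{\mathsf{G4CK}}\Gamma\Rightarrow\varphi$ if and only if $\Gamma\vdash\varphi$ is derivable in $\mathsf{CKH}$ (with $\Gamma$ regarded as the set of its elements). (ii) For every finite multiset $\Gamma$ and every multiset $\Delta$ with $|\Delta|\le 1$: $\vdash_{\mathsf{G4WK}}\Gamma\Rightarrow\Delta$ if and only if $\Gamma\vdash\delta$ is derivable in $\mathsf{WKH}$, where $\delta$ is the unique element of $\Delta$ if $\Delta$ is nonempty and $\delta=\bot$ if $\Delta=\emptyset$.
   Context: Formulas are built from a countably infinite set $\mathsf{Prop}$ of propositional variables by $\varphi ::= p \mid \bot \mid \varphi\wedge\varphi \mid \varphi\vee\varphi \mid \varphi\to\varphi \mid \Box\varphi \mid \Diamond\varphi$; $\neg\varphi:=\varphi\to\bot$. For a multiset $\Gamma$, $\Box^{-1}\Gamma=\{\varphi\mid\Box\varphi\in\Gamma\}$ and $\Diamond^{-1}\Gamma=\{\varphi\mid\Diamond\varphi\in\Gamma\}$ (with multiplicities). Sequent calculi: a sequent is $\Gamma\Rightarrow\Delta$ with $\Gamma,\Delta$ finite multisets; $\Gamma,\varphi$ means $\Gamma\uplus\{\varphi\}$; a single formula on the right denotes a singleton. In $\mathsf{G4CK}$ succedents have exactly one element; in $\mathsf{G4WK}$ at most one. Common rules ($p\in\mathsf{Prop}$, $\Delta$ an allowed succedent): ($\bot$L) $\Gamma,\bot\Rightarrow\Delta$ (no premises); (IdP) $\Gamma,p\Rightarrow p$ (no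 premises); ($\wedge$L) from $\Gamma,\varphi,\psi\Rightarrow\Delta$ infer $\Gamma,\varphi\wedge\psi\Rightarrow\Delta$; ($\wedge$R) from $\Gamma\Rightarrow\varphi$, $\Gamma\Rightarrow\psi$ infer $\Gamma\Rightarrow\varphi\wedge\psi$; ($\vee$L) from $\Gamma,\varphi\Rightarrow\Delta$, $\Gamma,\psi\Rightarrow\Delta$ infer $\Gamma,\varphi\vee\psi\Rightarrow\Delta$; ($\vee$R$_i$) from $\Gamma\Rightarrow\varphi_i$ infer $\Gamma\Rightarrow\varphi_1\vee\varphi_2$; ($\to$R) from $\Gamma,\varphi\Rightarrow\psi$ infer $\Gamma\Rightarrow\varphi\to\psi$; ($\wedge\!\to$L) from $\Gamma,\varphi\to(\psi\to\chi)\Rightarrow\Delta$ infer $\Gamma,(\varphi\wedge\psi)\to\chi\Rightarrow\Delta$; ($\vee\!\to$L) from $\Gamma,\varphi\to\chi,\psi\to\chi\Rightarrow\Delta$ infer $\Gamma,(\varphi\vee\psi)\to\chi\Rightarrow\Delta$; ($p\!\to$L) from $\Gamma,p,\varphi\Rightarrow\Delta$ infer $\Gamma,p,p\to\varphi\Rightarrow\Delta$; ($\to\to$L) from $\Gamma,\psi\to\chi\Rightarrow\varphi\to\psi$ and $\Gamma,\chi\Rightarrow\Delta$ infer $\Gamma,(\varphi\to\psi)\to\chi\Rightarrow\Delta$; ($\Box$R) from $\Box^{-1}\Gamma\Rightarrow\varphi$ infer $\Gamma\Rightarrow\Box\varphi$; ($\Box\!\to$L) from $\Box^{-1}\Gamma\Rightarrow\varphi$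 and $\Gamma,\psi\Rightarrow\Delta$ infer $\Gamma,\Box\varphi\to\psi\Rightarrow\Delta$; ($\Diamond\!\to$L) from $\Box^{-1}\Gamma,\gamma\Rightarrow\varphi$ and $\Gamma,\Diamond\gamma,\psi\Rightarrow\Delta$ infer $\Gamma,\Diamond\gamma,\Diamond\varphi\to\psi\Rightarrow\Delta$. $\mathsf{G4CK}$ additionally has ($\Diamond$L): from $\Box^{-1}\Gamma,\varphi\Rightarrow\psi$ infer $\Gamma,\Diamond\varphi\Rightarrow\Diamond\psi$; $\mathsf{G4WK}$ instead has ($\Diamond$L$'$): from $\Box^{-1}\Gamma,\varphi\Rightarrow\Diamond^{-1}\Delta$ infer $\Gamma,\Diamond\varphi\Rightarrow\Delta$. $\vdash_{\mathsf{S}}\Gamma\Rightarrow\Delta$ means a finite derivation exists in $\mathsf{S}$. Hilbert calculi: $\mathsf{CKH}$ derives consecutions $\Gamma\vdash\varphi$ ($\Gamma$ a set) by: $\Gamma\vdash\varphi$ for $\varphi$ an axiom instance; $\Gamma\vdash\varphi$ for $\varphi\in\Gamma$; from $\emptyset\vdash\varphi$ infer $\Gamma\vdash\Box\varphi$; from $\Gamma\vdash\varphi$ and $\Gamma\vdash\varphi\to\psi$ infer $\Gamma\vdash\psi$. Axioms of $\mathsf{CKH}$: all instances of $\varphi\to(\psi\to\varphi)$; $(\varphi\to(\psi\to\chi))\to((\varphi\to\psi)\to(\varphi\to\chi))$; $\varphi\to(\varphi\vee\psi)$; $\psi\to(\varphi\vee\psi)$; $(\varphi\to\chi)\to((\psi\to\chi)\to((\varphi\vee\psi)\to\chi))$;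 $(\varphi\wedge\psi)\to\varphi$; $(\varphi\wedge\psi)\to\psi$; $(\varphi\to\psi)\to((\varphi\to\chi)\to(\varphi\to(\psi\wedge\chi)))$; $\bot\to\varphi$; $\Box(\varphi\to\psi)\to(\Box\varphi\to\Box\psi)$; $\Box(\varphi\to\psi)\to(\Diamond\varphi\to\Diamond\psi)$. $\mathsf{WKH}$ is $\mathsf{CKH}$ with the additional axiom $\neg\Diamond\bot$. *)

theory Defs
  imports Main "HOL-Library.Multiset"
begin

datatype fm =
    Var nat
  | Falsum  (\<open>\<^bold>\<bottom>\<close>)
  | Conj fm fm  (infixr \<open>\<^bold>\<and>\<close> 57)
  | Disj fm fm  (infixr \<open>\<^bold>\<or>\<close> 56)
  | Imp fm fm  (infixr \<open>\<^bold>\<rightarrow>\<close> 55)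
  | is_Box: Box (unBox: fm)  (\<open>\<^bold>\<box> _\<close> [80] 80)
  | is_Dia: Dia (unDia: fm)  (\<open>\<^bold>\<diamond> _\<close> [80] 80)

abbreviation Neg :: "fm \<Rightarrow> fm"  (\<open>\<^bold>\<not> _\<close> [80] 80)
  where "\<^bold>\<not> \<phi> \<equiv> \<phi> \<^bold>\<rightarrow> \<^bold>\<bottom>"

definition box_inv :: "fm multiset \<Rightarrow> fm multiset"
  where "box_inv \<Gamma> = image_mset unBox (filter_mset is_Box \<Gamma>)"

definition dia_inv :: "fm multiset \<Rightarrow> fm multiset"
  where "dia_inv \<Gamma> = image_mset unDia (filter_mset is_Dia \<Gamma>)"

lemma count_box_inv: "count (box_inv \<Gamma>) \<phi> = count \<Gamma> (\<^bold>\<box> \<phi>)"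
proof (induction \<Gamma>)
  case (add x \<Gamma>)
  then show ?case by (cases x) (auto simp: box_inv_def)
qed (simp add: box_inv_def)

lemma count_dia_inv: "count (dia_inv \<Gamma>) \<phi> = count \<Gamma> (\<^bold>\<diamond> \<phi>)"
proof (induction \<Gamma>)
  case (add x \<Gamma>)
  then show ?case by (cases x) (auto simp: dia_inv_def)
qed (simp add: dia_inv_def)


datatype logic = CK | WK

fun succedent :: "logic \<Rightarrow> fm multiset \<Rightarrow> bool" where
  "succedent CK \<Delta> \<longleftrightarrow> size \<Delta> = 1"
| "succedent WK \<Delta> \<longleftrightarrow> size \<Delta> \<le> 1"

text \<open>The two sequent calculi differ only in the admissible succedents and in the left rule for
  the diamond. The condition on succedents is spelled out only in the rules where it is not
  inherited from a premise; see \<open>G4_succedent\<close> below.\<close>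

inductive G4 :: "logic \<Rightarrow> fm multiset \<Rightarrow> fm multiset \<Rightarrow> bool" for L where
  BotL: "succedent L \<Delta> \<Longrightarrow> G4 L (add_mset \<^bold>\<bottom> \<Gamma>) \<Delta>"
| IdP: "G4 L (add_mset (Var p) \<Gamma>) {#Var p#}"
| ConjL: "G4 L (add_mset \<psi> (add_mset \<phi> \<Gamma>)) \<Delta> \<Longrightarrow> G4 L (add_mset (\<phi> \<^bold>\<and> \<psi>) \<Gamma>) \<Delta>"
| ConjR: "G4 L \<Gamma> {#\<phi>#} \<Longrightarrow> G4 L \<Gamma> {#\<psi>#} \<Longrightarrow> G4 L \<Gamma> {#\<phi> \<^bold>\<and> \<psi>#}"
| DisjL: "G4 L (add_mset \<phi> \<Gamma>) \<Delta> \<Longrightarrow> G4 L (add_mset \<psi> \<Gamma>) \<Delta> \<Longrightarrow> G4 L (add_mset (\<phi> \<^bold>\<or> \<psi>) \<Gamma>) \<Delta>"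
| DisjR1: "G4 L \<Gamma> {#\<phi>#} \<Longrightarrow> G4 L \<Gamma> {#\<phi> \<^bold>\<or> \<psi>#}"
| DisjR2: "G4 L \<Gamma> {#\<psi>#} \<Longrightarrow> G4 L \<Gamma> {#\<phi> \<^bold>\<or> \<psi>#}"
| ImpR: "G4 L (add_mset \<phi> \<Gamma>) {#\<psi>#} \<Longrightarrow> G4 L \<Gamma> {#\<phi> \<^bold>\<rightarrow> \<psi>#}"
| ConjImpL: "G4 L (add_mset (\<phi> \<^bold>\<rightarrow> (\<psi> \<^bold>\<rightarrow> \<chi>)) \<Gamma>) \<Delta> \<Longrightarrow> G4 L (add_mset ((\<phi> \<^bold>\<and> \<psi>) \<^bold>\<rightarrow> \<chi>) \<Gamma>) \<Delta>"
| DisjImpL: "G4 L (add_mset (\<psi> \<^bold>\<rightarrow> \<chi>) (add_mset (\<phi> \<^bold>\<rightarrow> \<chi>) \<Gamma>)) \<Delta>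
    \<Longrightarrow> G4 L (add_mset ((\<phi> \<^bold>\<or> \<psi>) \<^bold>\<rightarrow> \<chi>) \<Gamma>) \<Delta>"
| VarImpL: "G4 L (add_mset \<phi> (add_mset (Var p) \<Gamma>)) \<Delta>
    \<Longrightarrow> G4 L (add_mset (Var p \<^bold>\<rightarrow> \<phi>) (add_mset (Var p) \<Gamma>)) \<Delta>"
| ImpImpL: "G4 L (add_mset (\<psi> \<^bold>\<rightarrow> \<chi>) \<Gamma>) {#\<phi> \<^bold>\<rightarrow> \<psi>#} \<Longrightarrow> G4 L (add_mset \<chi> \<Gamma>) \<Delta>
    \<Longrightarrow> G4 L (add_mset ((\<phi> \<^bold>\<rightarrow> \<psi>) \<^bold>\<rightarrow> \<chi>) \<Gamma>) \<Delta>"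
| BoxR: "G4 L (box_inv \<Gamma>) {#\<phi>#} \<Longrightarrow> G4 L \<Gamma> {#\<^bold>\<box> \<phi>#}"
| BoxImpL: "G4 L (box_inv \<Gamma>) {#\<phi>#} \<Longrightarrow> G4 L (add_mset \<psi> \<Gamma>) \<Delta>
    \<Longrightarrow> G4 L (add_mset (\<^bold>\<box> \<phi> \<^bold>\<rightarrow> \<psi>) \<Gamma>) \<Delta>"
| DiaImpL: "G4 L (add_mset \<gamma> (box_inv \<Gamma>)) {#\<phi>#}
    \<Longrightarrow> G4 L (add_mset \<psi> (add_mset (\<^bold>\<diamond> \<gamma>) \<Gamma>)) \<Delta>
    \<Longrightarrow> G4 L (add_mset (\<^bold>\<diamond> \<phi> \<^bold>\<rightarrow> \<psi>) (add_mset (\<^bold>\<diamond> \<gamma>) \<Gamma>)) \<Delta>"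
| DiaL: "L = CK \<Longrightarrow> G4 L (add_mset \<phi> (box_inv \<Gamma>)) {#\<psi>#}
    \<Longrightarrow> G4 L (add_mset (\<^bold>\<diamond> \<phi>) \<Gamma>) {#\<^bold>\<diamond> \<psi>#}"
| DiaL': "L = WK \<Longrightarrow> succedent L \<Delta> \<Longrightarrow> G4 L (add_mset \<phi> (box_inv \<Gamma>)) (dia_inv \<Delta>)
    \<Longrightarrow> G4 L (add_mset (\<^bold>\<diamond> \<phi>) \<Gamma>) \<Delta>"

lemma G4_succedent: "G4 L \<Gamma> \<Delta> \<Longrightarrow> succedent L \<Delta>"
  by (induction rule: G4.induct) (cases L; simp)+

abbreviation G4CK :: "fm multiset \<Rightarrow> fm multiset \<Rightarrow> bool"
  where "G4CK \<equiv> G4 CK"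

abbreviation G4WK :: "fm multiset \<Rightarrow> fm multiset \<Rightarrow> bool"
  where "G4WK \<equiv> G4 WK"


inductive axiom_CK :: "fm \<Rightarrow> bool" where
  "axiom_CK (\<phi> \<^bold>\<rightarrow> (\<psi> \<^bold>\<rightarrow> \<phi>))"
| "axiom_CK ((\<phi> \<^bold>\<rightarrow> (\<psi> \<^bold>\<rightarrow> \<chi>)) \<^bold>\<rightarrow> ((\<phi> \<^bold>\<rightarrow> \<psi>) \<^bold>\<rightarrow> (\<phi> \<^bold>\<rightarrow> \<chi>)))"
| "axiom_CK (\<phi> \<^bold>\<rightarrow> (\<phi> \<^bold>\<or> \<psi>))"
| "axiom_CK (\<psi> \<^bold>\<rightarrow> (\<phi> \<^bold>\<or> \<psi>))"
| "axiom_CK ((\<phi> \<^bold>\<rightarrow> \<chi>) \<^bold>\<rightarrow> ((\<psi> \<^bold>\<rightarrow> \<chi>) \<^bold>\<rightarrow> ((\<phi> \<^bold>\<or> \<psi>) \<^bold>\<rightarrow> \<chi>)))"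
| "axiom_CK ((\<phi> \<^bold>\<and> \<psi>) \<^bold>\<rightarrow> \<phi>)"
| "axiom_CK ((\<phi> \<^bold>\<and> \<psi>) \<^bold>\<rightarrow> \<psi>)"
| "axiom_CK ((\<phi> \<^bold>\<rightarrow> \<psi>) \<^bold>\<rightarrow> ((\<phi> \<^bold>\<rightarrow> \<chi>) \<^bold>\<rightarrow> (\<phi> \<^bold>\<rightarrow> (\<psi> \<^bold>\<and> \<chi>))))"
| "axiom_CK (\<^bold>\<bottom> \<^bold>\<rightarrow> \<phi>)"
| "axiom_CK (\<^bold>\<box> (\<phi> \<^bold>\<rightarrow> \<psi>) \<^bold>\<rightarrow> (\<^bold>\<box> \<phi> \<^bold>\<rightarrow> \<^bold>\<box> \<psi>))"
| "axiom_CK (\<^bold>\<box> (\<phi> \<^bold>\<rightarrow> \<psi>) \<^bold>\<rightarrow> (\<^bold>\<diamond> \<phi> \<^bold>\<rightarrow> \<^bold>\<diamond> \<psi>))"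

inductive axiom_WK :: "fm \<Rightarrow> bool" where
  "axiom_CK \<phi> \<Longrightarrow> axiom_WK \<phi>"
| "axiom_WK (\<^bold>\<not> \<^bold>\<diamond> \<^bold>\<bottom>)"

inductive hilbert :: "(fm \<Rightarrow> bool) \<Rightarrow> fm set \<Rightarrow> fm \<Rightarrow> bool" for Ax where
  Ax: "Ax \<phi> \<Longrightarrow> hilbert Ax \<Gamma> \<phi>"
| El: "\<phi> \<in> \<Gamma> \<Longrightarrow> hilbert Ax \<Gamma> \<phi>"
| Nec: "hilbert Ax {} \<phi> \<Longrightarrow> hilbert Ax \<Gamma> (\<^bold>\<box> \<phi>)"
| MP: "hilbert Ax \<Gamma> \<phi> \<Longrightarrow> hilbert Ax \<Gamma> (\<phi> \<^bold>\<rightarrow> \<psi>) \<Longrightarrow> hilbert Ax \<Gamma> \<psi>"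

abbreviation CKH :: "fm set \<Rightarrow> fm \<Rightarrow> bool"
  where "CKH \<equiv> hilbert axiom_CK"

abbreviation WKH :: "fm set \<Rightarrow> fm \<Rightarrow> bool"
  where "WKH \<equiv> hilbert axiom_WK"

text \<open>Only meaningful for multisets with at most one element.\<close>

definition succ_fm :: "fm multiset \<Rightarrow> fm"
  where "succ_fm \<Delta> = (if \<Delta> = {#} then \<^bold>\<bottom> else (THE \<delta>. \<delta> \<in># \<Delta>))"

lemma succ_fm_simps [simp]: "succ_fm {#} = \<^bold>\<bottom>" "succ_fm {#\<delta>#} = \<delta>"
  by (simp_all add: succ_fm_def)

end

theory Submission
  imports Defs
begin

text \<open>
  Sequent derivations translate to Hilbert derivations through the deduction theorem. Conversely,
  Hilbert derivations are sound for a Kripke semantics in which \<open>\<diamond>\<phi>\<close> says that each of a family of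
  neighbourhoods contains a world forcing \<open>\<phi>\<close>. The sequent calculi are cut-free complete for this
  semantics: backward proof search terminates, and if a sequent is underivable and no
  countermodel is inherited from a premise preserving its conclusion, then countermodels of
  the premises of the remaining rules can be glued below a new root. The neighbourhoods are needed
  because distinct instances of the left rules for the diamond refute distinct formulas. In this
  form no structural rule of the calculi has to be shown admissible.
\<close>

section \<open>Hilbert calculi\<close>

lemma hilbert_mono: "hilbert Ax \<Gamma> \<phi> \<Longrightarrow> \<Gamma> \<subseteq> \<Gamma>' \<Longrightarrow> hilbert Ax \<Gamma>' \<phi>"
  by (induction arbitrary: \<Gamma>' rule: hilbert.induct) (auto intro: hilbert.intros)

text \<open>Both axiom systems contain the CK axioms, and the facts collected here rest on those
  alone, so they are proved once for CK and WK.\<close>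

locale extends_CK =
  fixes Ax :: "fm \<Rightarrow> bool"
  assumes Ax_CK: "axiom_CK \<phi> \<Longrightarrow> Ax \<phi>"
begin

lemma CK: "axiom_CK \<phi> \<Longrightarrow> hilbert Ax \<Gamma> \<phi>"
  by (simp add: Ax_CK hilbert.Ax)

lemma weaken_imp: "hilbert Ax \<Gamma> \<psi> \<Longrightarrow> hilbert Ax \<Gamma> (\<phi> \<^bold>\<rightarrow> \<psi>)"
  by (meson CK axiom_CK.intros(1) hilbert.MP)

lemma imp_refl: "hilbert Ax \<Gamma> (\<phi> \<^bold>\<rightarrow> \<phi>)"
  by (meson CK axiom_CK.intros(1,2) hilbert.MP)

text \<open>Necessitation does not obstruct discharging the assumption: its premise has an empty
  context, so the boxed formula is derivable from \<open>\<Gamma>\<close> alone and can be weakened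
  to an implication.\<close>

lemma deduction: "hilbert Ax (insert \<phi> \<Gamma>) \<psi> \<Longrightarrow> hilbert Ax \<Gamma> (\<phi> \<^bold>\<rightarrow> \<psi>)"
proof (induction "insert \<phi> \<Gamma>" \<psi> rule: hilbert.induct)
  case (El \<psi>)
  then show ?case by (auto intro: weaken_imp imp_refl hilbert.El)
next
  case (MP \<psi> \<chi>)
  then show ?case by (meson CK axiom_CK.intros(2) hilbert.MP)
qed (auto intro: weaken_imp hilbert.intros)

lemma cut: "hilbert Ax \<Gamma> \<phi> \<Longrightarrow> hilbert Ax (insert \<phi> \<Gamma>) \<psi> \<Longrightarrow> hilbert Ax \<Gamma> \<psi>"
  using deduction hilbert.MP by blast

lemma replace_left:
  assumes "hilbert Ax (insert \<phi> \<Gamma>) \<psi>" and "hilbert Ax (insert \<chi> \<Gamma>) \<phi>"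
  shows "hilbert Ax (insert \<chi> \<Gamma>) \<psi>"
  using assms by (meson cut hilbert_mono insert_mono subset_insertI)

text \<open>A box is prefixed to each line of the derivation: the K axiom carries modus ponens,
  axioms are necessitated, and a necessitated line can be necessitated again. This handles the
  premises over \<open>box_inv\<close>.\<close>

lemma box_lift:
  "hilbert Ax \<Theta> \<phi> \<Longrightarrow> (\<And>\<theta>. \<theta> \<in> \<Theta> \<Longrightarrow> hilbert Ax \<Gamma> (\<^bold>\<box> \<theta>)) \<Longrightarrow> hilbert Ax \<Gamma> (\<^bold>\<box> \<phi>)"
proof (induction \<Theta> \<phi> rule: hilbert.induct)
  case (MP \<Theta> \<phi> \<psi>)
  then show ?case by (meson CK axiom_CK.intros(10) hilbert.MP)
qed (auto intro: hilbert.intros)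

text \<open>Discharging \<open>\<gamma>\<close> leaves an implication that \<open>box_lift\<close>
  can box; the axiom linking box and diamond then carries the diamond along it.\<close>

lemma dia_lift:
  assumes "hilbert Ax (insert \<gamma> \<Theta>) \<phi>" and "\<And>\<theta>. \<theta> \<in> \<Theta> \<Longrightarrow> hilbert Ax \<Gamma> (\<^bold>\<box> \<theta>)"
    and "hilbert Ax \<Gamma> (\<^bold>\<diamond> \<gamma>)"
  shows "hilbert Ax \<Gamma> (\<^bold>\<diamond> \<phi>)"
proof -
  have "hilbert Ax \<Gamma> (\<^bold>\<box> (\<gamma> \<^bold>\<rightarrow> \<phi>))"
    using assms(1,2) by (blast intro: box_lift deduction)
  with assms(3) show ?thesis
    by (meson CK axiom_CK.intros(11) hilbert.MP)
qed

lemma ex_falso: "hilbert Ax \<Gamma> \<^bold>\<bottom> \<Longrightarrow> hilbert Ax \<Gamma> \<phi>"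
  by (meson CK axiom_CK.intros(9) hilbert.MP)

lemma conjI: "hilbert Ax \<Gamma> \<phi> \<Longrightarrow> hilbert Ax \<Gamma> \<psi> \<Longrightarrow> hilbert Ax \<Gamma> (\<phi> \<^bold>\<and> \<psi>)"
  by (meson CK axiom_CK.intros(8) weaken_imp imp_refl hilbert.MP)

lemma conjD1: "hilbert Ax \<Gamma> (\<phi> \<^bold>\<and> \<psi>) \<Longrightarrow> hilbert Ax \<Gamma> \<phi>"
  by (meson CK axiom_CK.intros(6) hilbert.MP)

lemma conjD2: "hilbert Ax \<Gamma> (\<phi> \<^bold>\<and> \<psi>) \<Longrightarrow> hilbert Ax \<Gamma> \<psi>"
  by (meson CK axiom_CK.intros(7) hilbert.MP)

lemma disjI1: "hilbert Ax \<Gamma> \<phi> \<Longrightarrow> hilbert Ax \<Gamma> (\<phi> \<^bold>\<or> \<psi>)"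
  by (meson CK axiom_CK.intros(3) hilbert.MP)

lemma disjI2: "hilbert Ax \<Gamma> \<psi> \<Longrightarrow> hilbert Ax \<Gamma> (\<phi> \<^bold>\<or> \<psi>)"
  by (meson CK axiom_CK.intros(4) hilbert.MP)

lemma disjL:
  assumes "hilbert Ax (insert \<phi> \<Gamma>) \<chi>" and "hilbert Ax (insert \<psi> \<Gamma>) \<chi>"
  shows "hilbert Ax (insert (\<phi> \<^bold>\<or> \<psi>) \<Gamma>) \<chi>"
proof -
  have "hilbert Ax \<Gamma> ((\<phi> \<^bold>\<or> \<psi>) \<^bold>\<rightarrow> \<chi>)"
    using assms by (meson CK axiom_CK.intros(5) deduction hilbert.MP)
  then show ?thesis
    by (meson hilbert.El hilbert.MP hilbert_mono insertI1 subset_insertI)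
qed

lemma impL:
  assumes "hilbert Ax (insert (\<phi> \<^bold>\<rightarrow> \<psi>) \<Gamma>) \<phi>" and "hilbert Ax (insert \<psi> \<Gamma>) \<chi>"
  shows "hilbert Ax (insert (\<phi> \<^bold>\<rightarrow> \<psi>) \<Gamma>) \<chi>"
  using assms by (meson replace_left hilbert.El hilbert.MP insertI1)

end

interpretation CK: extends_CK axiom_CK
  by unfold_locales

interpretation WK: extends_CK axiom_WK
  by unfold_locales (rule axiom_WK.intros)

section \<open>From sequent derivations to Hilbert derivations\<close>

fun axioms_of :: "logic \<Rightarrow> fm \<Rightarrow> bool" where
  "axioms_of CK = axiom_CK"
| "axioms_of WK = axiom_WK"

lemma extends_CK_axioms_of: "extends_CK (axioms_of L)"
  by (cases L) (simp_all add: CK.extends_CK_axioms WK.extends_CK_axioms)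

lemma box_inv_add [simp]:
  "box_inv (add_mset \<phi> \<Gamma>) = (if is_Box \<phi> then add_mset (unBox \<phi>) (box_inv \<Gamma>) else box_inv \<Gamma>)"
  by (simp add: box_inv_def)

lemma mem_box_inv [simp]: "\<phi> \<in># box_inv \<Gamma> \<longleftrightarrow> \<^bold>\<box> \<phi> \<in># \<Gamma>"
  by (metis count_box_inv count_greater_zero_iff)

lemma hilbert_if_G4: "G4 L \<Gamma> \<Delta> \<Longrightarrow> hilbert (axioms_of L) (set_mset \<Gamma>) (succ_fm \<Delta>)"
proof (induction rule: G4.induct)
  interpret extends_CK "axioms_of L" by (rule extends_CK_axioms_of)
  let ?H = "hilbert (axioms_of L)"
  note El = hilbert.El and MP = hilbert.MP
  {
    case (BotL \<Delta> \<Gamma>)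
    show ?case by (rule ex_falso) (simp add: El)
  next
    case (IdP p \<Gamma>)
    show ?case by (simp add: El)
  next
    case (ConjL \<psi> \<phi> \<Gamma> \<Delta>)
    let ?\<Gamma> = "insert (\<phi> \<^bold>\<and> \<psi>) (set_mset \<Gamma>)"
    have conj: "?H (insert \<chi> ?\<Gamma>) (\<phi> \<^bold>\<and> \<psi>)" for \<chi> by (simp add: El)
    have 1: "?H ?\<Gamma> \<phi>"
      using conjD1[OF conj[of "\<phi> \<^bold>\<and> \<psi>"]] by simp
    have 2: "?H (insert \<phi> ?\<Gamma>) \<psi>"
      using conj by (rule conjD2)
    have "?H (insert \<psi> (insert \<phi> ?\<Gamma>)) (succ_fm \<Delta>)"
      using ConjL.IH by (rule hilbert_mono) auto
    from cut[OF 1 cut[OF 2 this]] show ?case by simp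
  next
    case (DisjImpL \<psi> \<chi> \<phi> \<Gamma> \<Delta>)
    let ?\<Gamma> = "insert ((\<phi> \<^bold>\<or> \<psi>) \<^bold>\<rightarrow> \<chi>) (set_mset \<Gamma>)"
    have 1: "?H ?\<Gamma> (\<phi> \<^bold>\<rightarrow> \<chi>)"
      by (rule deduction, rule MP[OF disjI1[OF El] El[of "(\<phi> \<^bold>\<or> \<psi>) \<^bold>\<rightarrow> \<chi>"]]) simp_all
    have 2: "?H (insert (\<phi> \<^bold>\<rightarrow> \<chi>) ?\<Gamma>) (\<psi> \<^bold>\<rightarrow> \<chi>)"
      by (rule deduction, rule MP[OF disjI2[OF El] El[of "(\<phi> \<^bold>\<or> \<psi>) \<^bold>\<rightarrow> \<chi>"]]) simp_all
    have "?H (insert (\<psi> \<^bold>\<rightarrow> \<chi>) (insert (\<phi> \<^bold>\<rightarrow> \<chi>) ?\<Gamma>)) (succ_fm \<Delta>)"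
      using DisjImpL.IH by (rule hilbert_mono) auto
    from cut[OF 1 cut[OF 2 this]] show ?case by simp
  next
    case (ConjImpL \<phi> \<psi> \<chi> \<Gamma> \<Delta>)
    have "?H (insert ((\<phi> \<^bold>\<and> \<psi>) \<^bold>\<rightarrow> \<chi>) (set_mset \<Gamma>)) (\<phi> \<^bold>\<rightarrow> \<psi> \<^bold>\<rightarrow> \<chi>)"
      by (intro deduction, rule MP[OF conjI[OF El El] El[of "(\<phi> \<^bold>\<and> \<psi>) \<^bold>\<rightarrow> \<chi>"]]) simp_all
    from replace_left[OF _ this] ConjImpL.IH show ?case by simp
  next
    case (VarImpL \<phi> p \<Gamma> \<Delta>)
    then show ?case by (simp add: impL El)
  next
    case (ImpImpL \<psi> \<chi> \<Gamma> \<phi> \<Delta>)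
    \<comment> \<open>By weakening, \<open>\<psi>\<close> yields
      \<open>\<phi> \<rightarrow> \<psi>\<close>, so the nested implication entails the formula that
      replaces it in the left premise.\<close>
    have "?H (insert ((\<phi> \<^bold>\<rightarrow> \<psi>) \<^bold>\<rightarrow> \<chi>) (set_mset \<Gamma>)) (\<psi> \<^bold>\<rightarrow> \<chi>)"
      by (intro deduction, rule MP[OF weaken_imp[OF El] El[of "(\<phi> \<^bold>\<rightarrow> \<psi>) \<^bold>\<rightarrow> \<chi>"]]) simp_all
    from replace_left[OF _ this] ImpImpL.IH
    have "?H (insert ((\<phi> \<^bold>\<rightarrow> \<psi>) \<^bold>\<rightarrow> \<chi>) (set_mset \<Gamma>)) (\<phi> \<^bold>\<rightarrow> \<psi>)"
      by simp
    with ImpImpL.IH(2) show ?case by (simp add: impL)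
  next
    case (BoxR \<Gamma> \<phi>)
    show ?case
      by (simp, rule box_lift[OF BoxR.IH[unfolded succ_fm_simps]]) (simp add: El)
  next
    case (BoxImpL \<Gamma> \<phi> \<psi> \<Delta>)
    have "?H (set_mset (add_mset (\<^bold>\<box> \<phi> \<^bold>\<rightarrow> \<psi>) \<Gamma>)) (\<^bold>\<box> \<phi>)"
      by (rule box_lift[OF BoxImpL.IH(1)[unfolded succ_fm_simps]]) (simp add: El)
    with BoxImpL.IH(2) show ?case by (simp add: impL)
  next
    case (DiaImpL \<gamma> \<Gamma> \<phi> \<psi> \<Delta>)
    have "?H (set_mset (add_mset (\<^bold>\<diamond> \<phi> \<^bold>\<rightarrow> \<psi>) (add_mset (\<^bold>\<diamond> \<gamma>) \<Gamma>))) (\<^bold>\<diamond> \<phi>)"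
      by (rule dia_lift[of \<gamma> "set_mset (box_inv \<Gamma>)"]) (use DiaImpL.IH(1) in \<open>simp_all add: El\<close>)
    with DiaImpL.IH(2) show ?case by (simp add: impL)
  next
    case (DiaL \<phi> \<Gamma> \<psi>)
    show ?case
      by (simp, rule dia_lift[of \<phi> "set_mset (box_inv \<Gamma>)"]) (use DiaL.IH in \<open>simp_all add: El\<close>)
  next
    case (DiaL' \<Delta> \<phi> \<Gamma>)
    have "\<Delta> = {#} \<or> (\<exists>\<delta>. \<Delta> = {#\<delta>#})"
      using DiaL'.hyps by (cases \<Delta>) auto
    then consider \<psi> where "\<Delta> = {#\<^bold>\<diamond> \<psi>#}" | "dia_inv \<Delta> = {#}"
      by (metis dia_inv_def filter_empty_mset filter_single_mset image_mset_empty is_Dia_def)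
    then show ?case
    proof cases
      case 1
      then have *: "dia_inv \<Delta> = {#\<psi>#}" by (simp add: dia_inv_def)
      show ?thesis
        unfolding 1 succ_fm_simps
        by (rule dia_lift[of \<phi> "set_mset (box_inv \<Gamma>)"]) (use * DiaL'.IH in \<open>simp_all add: El\<close>)
    next
      \<comment> \<open>The premise derives falsum, so the conclusion's context derives the diamond
        of falsum. The extra WK axiom refutes this, and any succedent follows.\<close>
      case 2
      let ?\<Gamma> = "set_mset (add_mset (\<^bold>\<diamond> \<phi>) \<Gamma>)"
      have "?H ?\<Gamma> (\<^bold>\<diamond> \<^bold>\<bottom>)"
        by (rule dia_lift[of \<phi> "set_mset (box_inv \<Gamma>)"]) (use 2 DiaL'.IH in \<open>simp_all add: El\<close>)
      moreover have "?H ?\<Gamma> (\<^bold>\<not> \<^bold>\<diamond> \<^bold>\<bottom>)"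
        using DiaL'.hyps by (simp add: hilbert.Ax axiom_WK.intros)
      ultimately show ?thesis by (rule ex_falso[OF MP])
    qed
  }
qed (use extends_CK_axioms_of[of L] in \<open>simp_all add: extends_CK.conjI extends_CK.disjI1
      extends_CK.disjI2 extends_CK.disjL extends_CK.deduction\<close>)

section \<open>Kripke trees\<close>

text \<open>Finite trees with three kinds of children: \<open>futures\<close> generate the
  intuitionistic order, \<open>boxes\<close> are plain modal successors, and each list in
  \<open>nbhds\<close> is one neighbourhood.\<close>

datatype world =
  World (atoms: "nat set") (futures: "world list") (boxes: "world list") (nbhds: "world list list")

definition future :: "world \<Rightarrow> world \<Rightarrow> bool"
  where "future = (\<lambda>w v. v \<in> set (futures w))\<^sup>*\<^sup>*"

lemma future_refl [simp]: "future w w"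
  by (simp add: future_def)

lemma future_trans: "future w v \<Longrightarrow> future v u \<Longrightarrow> future w u"
  by (simp add: future_def)

lemma future_cases:
  assumes "future w v"
  obtains "v = w" | u where "u \<in> set (futures w)" "future u v"
  using assms unfolding future_def by (auto elim: converse_rtranclpE)

lemma future_step: "v \<in> set (futures w) \<Longrightarrow> future w v"
  by (simp add: future_def r_into_rtranclp)

text \<open>Members of neighbourhoods count as successors for the box too, so that every witness of
  a diamond satisfies whatever is boxed.\<close>

definition succs :: "world \<Rightarrow> world set"
  where "succs w = set (boxes w) \<union> \<Union> (set ` set (nbhds w))"

text \<open>Quantifying over futures also for variables makes forcing monotone in every tree. An empty
  family of neighbourhoods makes every diamond true, which in \<open>CK\<close> does the work of
  fallible worlds.\<close>

primrec forces :: "logic \<Rightarrow> world \<Rightarrow> fm \<Rightarrow> bool" where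
  "forces L w (Var p) \<longleftrightarrow> (\<forall>v. future w v \<longrightarrow> p \<in> atoms v)"
| "forces L w \<^bold>\<bottom> \<longleftrightarrow> False"
| "forces L w (\<phi> \<^bold>\<and> \<psi>) \<longleftrightarrow> forces L w \<phi> \<and> forces L w \<psi>"
| "forces L w (\<phi> \<^bold>\<or> \<psi>) \<longleftrightarrow> forces L w \<phi> \<or> forces L w \<psi>"
| "forces L w (\<phi> \<^bold>\<rightarrow> \<psi>) \<longleftrightarrow> (\<forall>v. future w v \<longrightarrow> forces L v \<phi> \<longrightarrow> forces L v \<psi>)"
| "forces L w (\<^bold>\<box> \<phi>) \<longleftrightarrow> (\<forall>v. future w v \<longrightarrow> (\<forall>u \<in> succs v. forces L u \<phi>))"
| "forces L w (\<^bold>\<diamond> \<phi>) \<longleftrightarrow> (\<forall>v. future w v \<longrightarrow>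
    (\<forall>N \<in> set (nbhds v). \<exists>u \<in> set N. forces L u \<phi>) \<and>
    (L = WK \<longrightarrow> (\<exists>u \<in> succs v. forces L u \<phi>)))"

lemma forces_mono: "forces L w \<phi> \<Longrightarrow> future w v \<Longrightarrow> forces L v \<phi>"
  by (induction \<phi>) (auto dest: future_trans)

lemma forces_axiom_CK: "axiom_CK \<phi> \<Longrightarrow> forces L w \<phi>"
proof (induction rule: axiom_CK.induct)
  case (11 \<phi> \<psi>)
  \<comment> \<open>The witness in \<open>S\<close> is a successor, hence forces the boxed
    implication. \<open>S\<close> will be a single neighbourhood or, in WK, all of
    \<open>succs v\<close>.\<close>
  have *: "\<exists>u\<in>S. forces L u \<psi>"
    if "\<exists>u\<in>S. forces L u \<phi>" "S \<subseteq> succs v" "forces L v (\<^bold>\<box> (\<phi> \<^bold>\<rightarrow> \<psi>))" for S v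
  proof -
    have "forces L u (\<phi> \<^bold>\<rightarrow> \<psi>)" if "u \<in> succs v" for u
      using \<open>forces L v _\<close> that future_refl unfolding forces.simps(6) by blast
    with that show ?thesis
      by (meson forces.simps(5) future_refl subsetD)
  qed
  have "forces L v (\<^bold>\<diamond> \<psi>)" if box: "forces L v (\<^bold>\<box> (\<phi> \<^bold>\<rightarrow> \<psi>))" and dia: "forces L v (\<^bold>\<diamond> \<phi>)" for v
    unfolding forces.simps(7)
  proof (intro allI impI)
    fix u
    assume "future v u"
    then have u: "forces L u (\<^bold>\<box> (\<phi> \<^bold>\<rightarrow> \<psi>))"
      using box forces_mono by blast
    have u': "\<forall>N \<in> set (nbhds u). \<exists>x \<in> set N. forces L x \<phi>"
      "L = WK \<longrightarrow> (\<exists>x \<in> succs u. forces L x \<phi>)"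
      using dia \<open>future v u\<close> by simp_all
    show "(\<forall>N \<in> set (nbhds u). \<exists>x \<in> set N. forces L x \<psi>) \<and>
        (L = WK \<longrightarrow> (\<exists>x \<in> succs u. forces L x \<psi>))"
    proof (intro conjI ballI impI)
      show "\<exists>x \<in> set N. forces L x \<psi>" if "N \<in> set (nbhds u)" for N
        by (rule *[OF _ _ u]) (use u'(1) that in \<open>auto simp: succs_def\<close>)
      show "\<exists>x \<in> succs u. forces L x \<psi>" if "L = WK"
        by (rule *[OF _ _ u]) (use u'(2) that in auto)
    qed
  qed
  then have "forces L v (\<^bold>\<diamond> \<phi> \<^bold>\<rightarrow> \<^bold>\<diamond> \<psi>)" if "forces L v (\<^bold>\<box> (\<phi> \<^bold>\<rightarrow> \<psi>))" for v
    using forces_mono[OF that] by (simp only: forces.simps(5)) blast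
  then show ?case
    by (simp only: forces.simps(5)) blast
next
  case (10 \<phi> \<psi>)
  then show ?case by simp (meson future_refl future_trans)
next
  case (2 \<phi> \<psi> \<chi>)
  then show ?case by simp (meson future_refl future_trans)
next
  case (5 \<phi> \<chi> \<psi>)
  then show ?case by simp (meson future_trans)
next
  case (8 \<phi> \<psi> \<chi>)
  then show ?case by simp (meson future_trans)
qed (simp_all, meson forces_mono)

text \<open>For the extra WK axiom: a world forcing the diamond of falsum would, by reflexivity,
  itself need a successor forcing falsum.\<close>

lemma forces_axioms_of: "axioms_of L \<phi> \<Longrightarrow> forces L w \<phi>"
proof (cases L)
  case WK
  moreover have "\<exists>u. future v u" for v
    using future_refl by blast
  moreover assume "axioms_of L \<phi>"
  ultimately show ?thesis
    by (auto simp: axiom_WK.simps forces_axiom_CK)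
qed (simp add: forces_axiom_CK)

text \<open>The world is generalised because necessitation uses its premise at successors; the empty
  context makes that premise true at every world.\<close>

lemma hilbert_sound:
  "hilbert (axioms_of L) \<Gamma> \<phi> \<Longrightarrow> (\<And>\<gamma>. \<gamma> \<in> \<Gamma> \<Longrightarrow> forces L w \<gamma>) \<Longrightarrow> forces L w \<phi>"
proof (induction arbitrary: w rule: hilbert.induct)
  case (MP \<Gamma> \<phi> \<psi>)
  then show ?case by (meson forces.simps(5) future_refl)
qed (auto simp: forces_axioms_of)

section \<open>Gluing countermodels below a new root\<close>

definition separates :: "logic \<Rightarrow> world \<Rightarrow> fm multiset \<Rightarrow> fm multiset \<Rightarrow> bool" where
  "separates L w \<Gamma> \<Delta> \<longleftrightarrow> (\<forall>\<gamma> \<in># \<Gamma>. forces L w \<gamma>) \<and> (\<forall>\<delta> \<in># \<Delta>. \<not> forces L w \<delta>)"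

text \<open>Gathers one witness per element into a list, the form in which a \<open>world\<close>
  stores its children; the first conclusion keeps anything else out of the list.\<close>

lemma finite_choice_list:
  assumes "finite A" and "\<And>x. x \<in> A \<Longrightarrow> \<exists>y. P x y"
  obtains ys where "\<And>y. y \<in> set ys \<Longrightarrow> \<exists>x \<in> A. P x y" and "\<And>x. x \<in> A \<Longrightarrow> \<exists>y \<in> set ys. P x y"
proof -
  obtain f where f: "\<And>x. x \<in> A \<Longrightarrow> P x (f x)"
    using assms(2) by metis
  obtain xs where "set xs = A"
    using finite_list[OF assms(1)] by blast
  with f have "\<And>y. y \<in> set (map f xs) \<Longrightarrow> \<exists>x \<in> A. P x y"
    and "\<And>x. x \<in> A \<Longrightarrow> \<exists>y \<in> set (map f xs). P x y"
    by auto
  then show ?thesis by (rule that)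
qed

text \<open>The worlds for \<open>A\<close> become futures of the root, so by monotonicity the root
  cannot force any member of \<open>A\<close>. Those for \<open>B\<close> become box successors.
  Each \<open>\<delta>\<close> in \<open>D\<close> receives one neighbourhood that refutes
  \<open>\<delta>\<close> throughout and contains a witness for every diamond in
  \<open>\<Gamma>\<close>. In WK the worlds from \<open>E\<close> are further box successors
  realising the diamonds. All proper futures force \<open>\<Gamma>\<close> and all successors force
  \<open>box_inv \<Gamma>\<close>, so the modal formulas of \<open>\<Gamma>\<close> hold at the
  root.\<close>

lemma glue:
  assumes "finite A" and A: "\<And>\<alpha>. \<alpha> \<in> A \<Longrightarrow> \<exists>v. separates L v \<Gamma> {#\<alpha>#}"
    and "finite B" and B: "\<And>\<beta>. \<beta> \<in> B \<Longrightarrow> \<exists>u. separates L u (box_inv \<Gamma>) {#\<beta>#}"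
    and "finite D" and D: "\<And>\<delta> \<gamma>. \<delta> \<in> D \<Longrightarrow> \<^bold>\<diamond> \<gamma> \<in># \<Gamma> \<Longrightarrow>
      \<exists>u. separates L u (add_mset \<gamma> (box_inv \<Gamma>)) {#\<delta>#}"
    and E: "\<And>\<gamma>. L = WK \<Longrightarrow> \<^bold>\<diamond> \<gamma> \<in># \<Gamma> \<Longrightarrow> \<exists>u. separates L u (add_mset \<gamma> (box_inv \<Gamma>)) {#}"
  obtains r where "\<And>v. future r v \<Longrightarrow> v = r \<or> separates L v \<Gamma> {#}"
    and "\<And>p. forces L r (Var p) \<longleftrightarrow> Var p \<in># \<Gamma>"
    and "\<And>\<phi>. \<^bold>\<box> \<phi> \<in># \<Gamma> \<Longrightarrow> forces L r (\<^bold>\<box> \<phi>)"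
    and "\<And>\<phi>. \<^bold>\<diamond> \<phi> \<in># \<Gamma> \<Longrightarrow> forces L r (\<^bold>\<diamond> \<phi>)"
    and "\<And>\<alpha>. \<alpha> \<in> A \<Longrightarrow> \<not> forces L r \<alpha>"
    and "\<And>\<beta>. \<beta> \<in> B \<Longrightarrow> \<not> forces L r (\<^bold>\<box> \<beta>)"
    and "\<And>\<delta>. \<delta> \<in> D \<Longrightarrow> \<not> forces L r (\<^bold>\<diamond> \<delta>)"
proof -
  let ?G = "{\<gamma>. \<^bold>\<diamond> \<gamma> \<in># \<Gamma>}"
  have finG: "finite ?G"
    using finite_vimageI[of "set_mset \<Gamma>" Dia] by (simp add: inj_def vimage_def)
  obtain vs where vs: "\<And>v. v \<in> set vs \<Longrightarrow> \<exists>\<alpha> \<in> A. separates L v \<Gamma> {#\<alpha>#}"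
    "\<And>\<alpha>. \<alpha> \<in> A \<Longrightarrow> \<exists>v \<in> set vs. separates L v \<Gamma> {#\<alpha>#}"
    using finite_choice_list[of A "\<lambda>\<alpha> v. separates L v \<Gamma> {#\<alpha>#}", OF \<open>finite A\<close> A] by blast
  obtain bs where bs: "\<And>u. u \<in> set bs \<Longrightarrow> \<exists>\<beta> \<in> B. separates L u (box_inv \<Gamma>) {#\<beta>#}"
    "\<And>\<beta>. \<beta> \<in> B \<Longrightarrow> \<exists>u \<in> set bs. separates L u (box_inv \<Gamma>) {#\<beta>#}"
    using finite_choice_list[of B "\<lambda>\<beta> u. separates L u (box_inv \<Gamma>) {#\<beta>#}", OF \<open>finite B\<close> B] by blast
  \<comment> \<open>These worlds meet the existence demand in the WK clause for diamonds; in CK the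
    empty list is chosen.\<close>
  have "\<exists>es. (\<forall>u \<in> set es. separates L u (box_inv \<Gamma>) {#}) \<and>
      (L = WK \<longrightarrow> (\<forall>\<gamma> \<in> ?G. \<exists>u \<in> set es. forces L u \<gamma>))"
  proof (cases "L = WK")
    case True
    then have "\<exists>u. separates L u (add_mset \<gamma> (box_inv \<Gamma>)) {#}" if "\<gamma> \<in> ?G" for \<gamma>
      using that E by simp
    from finite_choice_list[where P = "\<lambda>\<gamma> u. separates L u (add_mset \<gamma> (box_inv \<Gamma>)) {#}", OF finG this]
    obtain es where
      "\<And>u. u \<in> set es \<Longrightarrow> \<exists>\<gamma> \<in> ?G. separates L u (add_mset \<gamma> (box_inv \<Gamma>)) {#}"
      "\<And>\<gamma>. \<gamma> \<in> ?G \<Longrightarrow> \<exists>u \<in> set es. separates L u (add_mset \<gamma> (box_inv \<Gamma>)) {#}"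
      by blast
    then show ?thesis
      by (intro exI[of _ es]) (fastforce simp: separates_def)
  next
    case False
    then show ?thesis by (intro exI[of _ "[]"]) simp
  qed
  then obtain es where es: "\<And>u. u \<in> set es \<Longrightarrow> separates L u (box_inv \<Gamma>) {#}"
    "\<And>\<gamma>. L = WK \<Longrightarrow> \<^bold>\<diamond> \<gamma> \<in># \<Gamma> \<Longrightarrow> \<exists>u \<in> set es. forces L u \<gamma>"
    by blast
  \<comment> \<open>If \<open>\<Gamma>\<close> contains no diamond, the list chosen below is empty,
    and an empty neighbourhood refutes every diamond.\<close>
  let ?N = "\<lambda>\<delta> N. (\<forall>u \<in> set N. separates L u (box_inv \<Gamma>) {#\<delta>#}) \<and>
    (\<forall>\<gamma> \<in> ?G. \<exists>u \<in> set N. forces L u \<gamma>)"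
  have "\<exists>N. ?N \<delta> N" if "\<delta> \<in> D" for \<delta>
  proof -
    have "\<exists>u. separates L u (add_mset \<gamma> (box_inv \<Gamma>)) {#\<delta>#}" if "\<gamma> \<in> ?G" for \<gamma>
      using that \<open>\<delta> \<in> D\<close> D by simp
    from finite_choice_list[where P = "\<lambda>\<gamma> u. separates L u (add_mset \<gamma> (box_inv \<Gamma>)) {#\<delta>#}", OF finG this]
    obtain N where
      "\<And>u. u \<in> set N \<Longrightarrow> \<exists>\<gamma> \<in> ?G. separates L u (add_mset \<gamma> (box_inv \<Gamma>)) {#\<delta>#}"
      "\<And>\<gamma>. \<gamma> \<in> ?G \<Longrightarrow> \<exists>u \<in> set N. separates L u (add_mset \<gamma> (box_inv \<Gamma>)) {#\<delta>#}"
      by blast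
    then show ?thesis
      by (intro exI[of _ N]) (fastforce simp: separates_def)
  qed
  from finite_choice_list[where P = ?N, OF \<open>finite D\<close> this] obtain Ns where
    Ns: "\<And>N. N \<in> set Ns \<Longrightarrow> \<exists>\<delta> \<in> D. ?N \<delta> N" "\<And>\<delta>. \<delta> \<in> D \<Longrightarrow> \<exists>N \<in> set Ns. ?N \<delta> N"
    by blast
  define r where "r = World {p. Var p \<in># \<Gamma>} vs (bs @ es) Ns"
  then have sel: "atoms r = {p. Var p \<in># \<Gamma>}" "futures r = vs" "boxes r = bs @ es" "nbhds r = Ns"
    by simp_all
  have fut: "v = r \<or> separates L v \<Gamma> {#}" if "future r v" for v
    using that
  proof (cases rule: future_cases)
    case (2 u)
    with vs(1)[of u] show ?thesis
      by (auto simp: sel separates_def intro: forces_mono)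
  qed simp
  have succs_r: "separates L u (box_inv \<Gamma>) {#}" if "u \<in> succs r" for u
    using that bs(1)[of u] es(1)[of u] Ns(1) by (fastforce simp: sel succs_def separates_def)
  show ?thesis
  proof (rule that[of r])
    show "v = r \<or> separates L v \<Gamma> {#}" if "future r v" for v
      using that by (rule fut)
    show "forces L r (Var p) \<longleftrightarrow> Var p \<in># \<Gamma>" for p
    proof
      assume "Var p \<in># \<Gamma>"
      then have "p \<in> atoms v" if "future r v" for v
        using fut[OF that] by (fastforce simp: sel separates_def)
      then show "forces L r (Var p)" by simp
    next
      assume "forces L r (Var p)"
      then have "p \<in> atoms r" by simp
      then show "Var p \<in># \<Gamma>" by (simp add: sel)
    qed
    show "forces L r (\<^bold>\<box> \<phi>)" if "\<^bold>\<box> \<phi> \<in># \<Gamma>" for \<phi>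
    proof -
      have "forces L u \<phi>" if "future r v" "u \<in> succs v" for v u
        using fut[OF that(1)]
      proof
        assume "v = r"
        with that(2) succs_r[of u] \<open>\<^bold>\<box> \<phi> \<in># \<Gamma>\<close> show ?thesis by (simp add: separates_def)
      next
        assume "separates L v \<Gamma> {#}"
        with \<open>\<^bold>\<box> \<phi> \<in># \<Gamma>\<close> have "forces L v (\<^bold>\<box> \<phi>)"
          unfolding separates_def by blast
        with that(2) show ?thesis using future_refl[of v] unfolding forces.simps(6) by blast
      qed
      then show ?thesis by simp
    qed
    show "forces L r (\<^bold>\<diamond> \<phi>)" if "\<^bold>\<diamond> \<phi> \<in># \<Gamma>" for \<phi>
    proof -
      have 1: "\<exists>u \<in> set N. forces L u \<phi>" if "N \<in> set (nbhds r)" for N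
        using Ns(1)[of N] that \<open>\<^bold>\<diamond> \<phi> \<in># \<Gamma>\<close> by (auto simp: sel)
      have 2: "\<exists>u \<in> succs r. forces L u \<phi>" if "L = WK"
        using es(2)[OF that \<open>\<^bold>\<diamond> \<phi> \<in># \<Gamma>\<close>] by (auto simp: sel succs_def)
      show ?thesis
        unfolding forces.simps(7)
      proof (intro allI impI)
        fix v
        assume "future r v"
        then show "(\<forall>N \<in> set (nbhds v). \<exists>u \<in> set N. forces L u \<phi>) \<and>
            (L = WK \<longrightarrow> (\<exists>u \<in> succs v. forces L u \<phi>))"
        proof (cases "v = r")
          case True
          with 1 2 show ?thesis by blast
        next
          case False
          with fut[OF \<open>future r v\<close>] that have "forces L v (\<^bold>\<diamond> \<phi>)"
            unfolding separates_def by blast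
          then show ?thesis using future_refl[of v] unfolding forces.simps(7) by blast
        qed
      qed
    qed
    show "\<not> forces L r \<alpha>" if "\<alpha> \<in> A" for \<alpha>
      using vs(2)[OF that] forces_mono[of L r \<alpha>] future_step[of _ r]
      by (auto simp: separates_def sel)
    show "\<not> forces L r (\<^bold>\<box> \<beta>)" if \<beta>: "\<beta> \<in> B" for \<beta>
    proof
      obtain u where "u \<in> succs r" "\<not> forces L u \<beta>"
        using bs(2)[OF \<beta>] by (auto simp: separates_def succs_def sel)
      moreover assume "forces L r (\<^bold>\<box> \<beta>)"
      ultimately show False
        using future_refl[of r] unfolding forces.simps(6) by blast
    qed
    show "\<not> forces L r (\<^bold>\<diamond> \<delta>)" if \<delta>: "\<delta> \<in> D" for \<delta>
    proof
      obtain N where "N \<in> set (nbhds r)" "\<forall>u \<in> set N. \<not> forces L u \<delta>"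
        using Ns(2)[OF \<delta>] by (auto simp: separates_def sel)
      moreover assume "forces L r (\<^bold>\<diamond> \<delta>)"
      ultimately show False
        using future_refl[of r] unfolding forces.simps(7) by blast
    qed
  qed
qed

section \<open>Countermodels from failed proof search\<close>

primrec weight :: "fm \<Rightarrow> nat" where
  "weight (Var p) = 1"
| "weight \<^bold>\<bottom> = 1"
| "weight (\<phi> \<^bold>\<and> \<psi>) = weight \<phi> + weight \<psi> + 2"
| "weight (\<phi> \<^bold>\<or> \<psi>) = weight \<phi> + weight \<psi> + 1"
| "weight (\<phi> \<^bold>\<rightarrow> \<psi>) = weight \<phi> + weight \<psi> + 1"
| "weight (\<^bold>\<box> \<phi>) = weight \<phi> + 1"
| "weight (\<^bold>\<diamond> \<phi>) = weight \<phi> + 1"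

text \<open>Every premise arises by replacing formulas of the conclusion by at most two formulas of
  smaller weight each, so that powers of three can stand in for the multiset ordering. The extra
  unit on conjunctions makes \<open>\<phi> \<rightarrow> (\<psi> \<rightarrow> \<chi>)\<close> lighter than \<open>(\<phi> \<and> \<psi>) \<rightarrow> \<chi>\<close>.\<close>

definition cost :: "fm multiset \<Rightarrow> nat"
  where "cost \<Gamma> = (\<Sum>\<gamma> \<in># \<Gamma>. 3 ^ weight \<gamma>)"

lemma cost_simps [simp]: "cost {#} = 0" "cost (add_mset \<phi> \<Gamma>) = 3 ^ weight \<phi> + cost \<Gamma>"
  by (simp_all add: cost_def)

lemma cost_box_inv: "cost (box_inv \<Gamma>) \<le> cost \<Gamma>"
proof (induction \<Gamma>)
  case (add \<phi> \<Gamma>)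
  then show ?case by (cases \<phi>) auto
qed (simp add: box_inv_def)

lemma power_three_less: "a < c \<Longrightarrow> (3::nat) ^ a < 3 ^ c"
  by simp

text \<open>Both exponents are at most \<open>c - 1\<close>, so the sum is at most twice
  \<open>3 ^ (c - 1)\<close>. With base two, equality with the bound could occur.\<close>

lemma power_three_add_less:
  assumes "a < c" "b < c"
  shows "(3::nat) ^ a + 3 ^ b < 3 ^ c"
proof -
  obtain n where c: "c = Suc n"
    using assms by (cases c) auto
  with assms have "(3::nat) ^ a \<le> 3 ^ n" "(3::nat) ^ b \<le> 3 ^ n"
    by (simp_all add: power_increasing)
  moreover have "(0::nat) < 3 ^ n" by simp
  ultimately show ?thesis unfolding c power_Suc by linarith
qed

lemma weight_pos: "0 < weight \<phi>"
  by (cases \<phi>) auto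

lemma finite_antecedents: "finite {\<alpha>. \<exists>\<chi>. \<alpha> \<^bold>\<rightarrow> \<chi> \<in># \<Gamma>}"
proof (rule finite_subset)
  \<comment> \<open>The default value \<open>\<gamma>\<close> merely enlarges the finite
    superset.\<close>
  show "{\<alpha>. \<exists>\<chi>. \<alpha> \<^bold>\<rightarrow> \<chi> \<in># \<Gamma>} \<subseteq> (\<lambda>\<gamma>. case \<gamma> of \<alpha> \<^bold>\<rightarrow> \<chi> \<Rightarrow> \<alpha> | _ \<Rightarrow> \<gamma>) ` set_mset \<Gamma>"
    by (force simp: image_iff)
qed simp

lemma finite_disjuncts: "finite {\<alpha>. \<exists>\<psi>. \<alpha> \<^bold>\<or> \<psi> \<in># \<Delta> \<or> \<psi> \<^bold>\<or> \<alpha> \<in># \<Delta>}"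
proof (rule finite_subset)
  show "{\<alpha>. \<exists>\<psi>. \<alpha> \<^bold>\<or> \<psi> \<in># \<Delta> \<or> \<psi> \<^bold>\<or> \<alpha> \<in># \<Delta>} \<subseteq>
      (\<Union>\<delta> \<in> set_mset \<Delta>. case \<delta> of \<phi> \<^bold>\<or> \<psi> \<Rightarrow> {\<phi>, \<psi>} | _ \<Rightarrow> {})"
    by force
qed (auto split: fm.split)

lemma two_members_split:
  "a \<in># M \<Longrightarrow> b \<in># M \<Longrightarrow> a \<noteq> b \<Longrightarrow> \<exists>N. M = add_mset a (add_mset b N)"
  by (metis insert_noteq_member multi_member_split)

text \<open>Induction on cost. Unprovability makes a premise of every applicable rule fail, while
  the contrary assumption \<open>none\<close> excludes failing premises whose countermodels already
  serve the conclusion. Countermodels of the other failing premises become the children of the root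
  supplied by \<open>glue\<close>.\<close>

lemma countermodel:
  "succedent L \<Delta> \<Longrightarrow> \<not> G4 L \<Gamma> \<Delta> \<Longrightarrow> \<exists>w. separates L w \<Gamma> \<Delta>"
proof (induction "cost \<Gamma> + cost \<Delta>" arbitrary: \<Gamma> \<Delta> rule: less_induct)
  case less
  \<comment> \<open>Powers are to be compared through their exponents, so successor exponents must
    not be unfolded into products.\<close>
  note power_Suc [simp del]
  note IH = less.hyps and unprovable = \<open>\<not> G4 L \<Gamma> \<Delta>\<close>
  show ?case
  proof (rule ccontr)
    assume none: "\<nexists>w. separates L w \<Gamma> \<Delta>"
    have succ1 [simp]: "succedent L {#\<phi>#}" for \<phi>
      by (cases L) auto
    \<comment> \<open>A semantic form of invertibility: a countermodel of a premise with the same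
      succedent and an antecedent at least as strong would separate the conclusion, against
      \<open>none\<close>. Such premises are therefore provable, which rules out several shapes of
      formula in \<open>\<Gamma>\<close>.\<close>
    have pres: "G4 L \<Gamma>' \<Delta>"
      if less: "cost \<Gamma>' < cost \<Gamma>"
        and pull: "\<And>w. \<forall>\<gamma> \<in># \<Gamma>'. forces L w \<gamma> \<Longrightarrow> \<forall>\<gamma> \<in># \<Gamma>. forces L w \<gamma>" for \<Gamma>'
    proof (rule ccontr)
      assume "\<not> G4 L \<Gamma>' \<Delta>"
      then obtain w where "separates L w \<Gamma>' \<Delta>"
        using IH[of \<Gamma>' \<Delta>] less \<open>succedent L \<Delta>\<close> by auto
      then have "separates L w \<Gamma> \<Delta>"
        using pull[of w] unfolding separates_def by blast
      with none show False by blast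
    qed
    note p3 = power_three_less power_three_add_less
    have noBot: "\<^bold>\<bottom> \<notin># \<Gamma>"
      using unprovable \<open>succedent L \<Delta>\<close> by (metis G4.BotL multi_member_split)
    have noConj: "\<phi> \<^bold>\<and> \<psi> \<notin># \<Gamma>" for \<phi> \<psi>
    proof
      assume "\<phi> \<^bold>\<and> \<psi> \<in># \<Gamma>"
      then obtain \<Gamma>' where \<Gamma>: "\<Gamma> = add_mset (\<phi> \<^bold>\<and> \<psi>) \<Gamma>'" by (metis multi_member_split)
      have "G4 L (add_mset \<psi> (add_mset \<phi> \<Gamma>')) \<Delta>"
        using p3(2)[of "weight \<psi>" "weight (\<phi> \<^bold>\<and> \<psi>)" "weight \<phi>"] by (intro pres) (auto simp: \<Gamma>)
      with unprovable \<Gamma> show False by (simp add: G4.ConjL)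
    qed
    have noDisj: "\<phi> \<^bold>\<or> \<psi> \<notin># \<Gamma>" for \<phi> \<psi>
    proof
      assume "\<phi> \<^bold>\<or> \<psi> \<in># \<Gamma>"
      then obtain \<Gamma>' where \<Gamma>: "\<Gamma> = add_mset (\<phi> \<^bold>\<or> \<psi>) \<Gamma>'" by (metis multi_member_split)
      have "G4 L (add_mset \<phi> \<Gamma>') \<Delta>" "G4 L (add_mset \<psi> \<Gamma>') \<Delta>"
        by (intro pres; auto simp: \<Gamma>)+
      with unprovable \<Gamma> show False by (simp add: G4.DisjL)
    qed
    have noConjImp: "(\<phi> \<^bold>\<and> \<psi>) \<^bold>\<rightarrow> \<chi> \<notin># \<Gamma>" for \<phi> \<psi> \<chi>
    proof
      assume "(\<phi> \<^bold>\<and> \<psi>) \<^bold>\<rightarrow> \<chi> \<in># \<Gamma>"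
      then obtain \<Gamma>' where \<Gamma>: "\<Gamma> = add_mset ((\<phi> \<^bold>\<and> \<psi>) \<^bold>\<rightarrow> \<chi>) \<Gamma>'" by (metis multi_member_split)
      have "G4 L (add_mset (\<phi> \<^bold>\<rightarrow> \<psi> \<^bold>\<rightarrow> \<chi>) \<Gamma>') \<Delta>"
        by (rule pres) (auto simp: \<Gamma>)
      with unprovable \<Gamma> show False by (simp add: G4.ConjImpL)
    qed
    have noDisjImp: "(\<phi> \<^bold>\<or> \<psi>) \<^bold>\<rightarrow> \<chi> \<notin># \<Gamma>" for \<phi> \<psi> \<chi>
    proof
      assume "(\<phi> \<^bold>\<or> \<psi>) \<^bold>\<rightarrow> \<chi> \<in># \<Gamma>"
      then obtain \<Gamma>' where \<Gamma>: "\<Gamma> = add_mset ((\<phi> \<^bold>\<or> \<psi>) \<^bold>\<rightarrow> \<chi>) \<Gamma>'" by (metis multi_member_split)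
      have "G4 L (add_mset (\<psi> \<^bold>\<rightarrow> \<chi>) (add_mset (\<phi> \<^bold>\<rightarrow> \<chi>) \<Gamma>')) \<Delta>"
        using p3(2)[of "weight (\<psi> \<^bold>\<rightarrow> \<chi>)" "weight ((\<phi> \<^bold>\<or> \<psi>) \<^bold>\<rightarrow> \<chi>)" "weight (\<phi> \<^bold>\<rightarrow> \<chi>)"]
          weight_pos[of \<phi>] weight_pos[of \<psi>] by (intro pres) (auto simp: \<Gamma>)
      with unprovable \<Gamma> show False by (simp add: G4.DisjImpL)
    qed
    \<comment> \<open>A world forcing \<open>\<chi>\<close> forces the implication by persistence.
      Hence in each two-premise rule for an implication on the left, the premise with
      \<open>\<chi>\<close> is provable and the failure lies in the other one.\<close>
    have imp_keep: "G4 L (add_mset \<chi> \<Gamma>') \<Delta>" if \<Gamma>: "\<Gamma> = add_mset (\<alpha> \<^bold>\<rightarrow> \<chi>) \<Gamma>'" for \<alpha> \<chi> \<Gamma>'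
      by (rule pres) (auto simp: \<Gamma> intro: forces_mono)
    have noVarImp: "Var p \<notin># \<Gamma>" if "Var p \<^bold>\<rightarrow> \<chi> \<in># \<Gamma>" for p \<chi>
    proof
      assume "Var p \<in># \<Gamma>"
      with that obtain \<Gamma>' where \<Gamma>: "\<Gamma> = add_mset (Var p \<^bold>\<rightarrow> \<chi>) (add_mset (Var p) \<Gamma>')"
        using two_members_split[of "Var p \<^bold>\<rightarrow> \<chi>" \<Gamma> "Var p"] by auto
      have "G4 L \<Gamma> \<Delta>"
        unfolding \<Gamma> by (rule G4.VarImpL[OF imp_keep[OF \<Gamma>]])
      with unprovable show False by contradiction
    qed
    have IH1: "\<exists>u. separates L u \<Gamma>' {#\<phi>#}"
      if "cost \<Gamma>' + 3 ^ weight \<phi> < cost \<Gamma> + cost \<Delta>" "\<not> G4 L \<Gamma>' {#\<phi>#}" for \<Gamma>' \<phi>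
      using that by (intro IH) auto
    have \<Delta>_cases: "\<Delta> = {#\<delta>#}" if "\<delta> \<in># \<Delta>" for \<delta>
      using that \<open>succedent L \<Delta>\<close> by (cases L) (auto dest!: multi_member_split)

    have A_imp: "\<exists>v. separates L v \<Gamma> {#\<phi> \<^bold>\<rightarrow> \<psi>#}" if "(\<phi> \<^bold>\<rightarrow> \<psi>) \<^bold>\<rightarrow> \<chi> \<in># \<Gamma>" for \<phi> \<psi> \<chi>
    proof -
      from that obtain \<Gamma>' where \<Gamma>: "\<Gamma> = add_mset ((\<phi> \<^bold>\<rightarrow> \<psi>) \<^bold>\<rightarrow> \<chi>) \<Gamma>'"
        by (metis multi_member_split)
      have "\<not> G4 L (add_mset (\<psi> \<^bold>\<rightarrow> \<chi>) \<Gamma>') {#\<phi> \<^bold>\<rightarrow> \<psi>#}"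
        using unprovable imp_keep[OF \<Gamma>] \<Gamma> by (auto intro: G4.ImpImpL)
      then obtain v where v: "separates L v (add_mset (\<psi> \<^bold>\<rightarrow> \<chi>) \<Gamma>') {#\<phi> \<^bold>\<rightarrow> \<psi>#}"
        using IH1[of "add_mset (\<psi> \<^bold>\<rightarrow> \<chi>) \<Gamma>'" "\<phi> \<^bold>\<rightarrow> \<psi>"] weight_pos[of \<phi>] weight_pos[of \<chi>]
          p3(2)[of "weight (\<psi> \<^bold>\<rightarrow> \<chi>)" "weight ((\<phi> \<^bold>\<rightarrow> \<psi>) \<^bold>\<rightarrow> \<chi>)" "weight (\<phi> \<^bold>\<rightarrow> \<psi>)"]
        by (auto simp: \<Gamma>)
      \<comment> \<open>The world \<open>v\<close> may fail to force
        \<open>(\<phi> \<rightarrow> \<psi>) \<rightarrow> \<chi>\<close>. At and above a future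
        \<open>u\<close> that forces \<open>\<phi>\<close> but not \<open>\<psi>\<close>, however,
        \<open>\<phi> \<rightarrow> \<psi>\<close> gives \<open>\<psi>\<close> and thus
        \<open>\<chi>\<close>, while \<open>u\<close> still refutes
        \<open>\<phi> \<rightarrow> \<psi>\<close>.\<close>
      then obtain u where u: "future v u" "forces L u \<phi>" "\<not> forces L u \<psi>"
        by (auto simp: separates_def)
      have "forces L v (\<psi> \<^bold>\<rightarrow> \<chi>)" and "\<forall>\<gamma> \<in># \<Gamma>'. forces L v \<gamma>"
        using v unfolding separates_def by auto
      then have "forces L u (\<psi> \<^bold>\<rightarrow> \<chi>)" and "\<forall>\<gamma> \<in># \<Gamma>'. forces L u \<gamma>"
        using forces_mono[OF _ u(1)] by blast+
      moreover from this(1) have "forces L u ((\<phi> \<^bold>\<rightarrow> \<psi>) \<^bold>\<rightarrow> \<chi>)"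
        using forces_mono[OF u(2)] by simp
      moreover have "\<not> forces L u (\<phi> \<^bold>\<rightarrow> \<psi>)"
        using u future_refl unfolding forces.simps(5) by blast
      ultimately have "separates L u \<Gamma> {#\<phi> \<^bold>\<rightarrow> \<psi>#}"
        by (auto simp: separates_def \<Gamma>)
      then show ?thesis by blast
    qed
    have A_disj: "\<exists>v. separates L v \<Gamma> {#\<alpha>#}" if "\<alpha> \<^bold>\<or> \<psi> \<in># \<Delta> \<or> \<psi> \<^bold>\<or> \<alpha> \<in># \<Delta>" for \<alpha> \<psi>
    proof -
      from that obtain \<delta> where \<Delta>: "\<Delta> = {#\<delta>#}" and \<delta>: "\<delta> = \<alpha> \<^bold>\<or> \<psi> \<or> \<delta> = \<psi> \<^bold>\<or> \<alpha>"
        using \<Delta>_cases by blast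
      from \<delta> unprovable have "\<not> G4 L \<Gamma> {#\<alpha>#}"
        by (auto simp: \<Delta> G4.DisjR1 G4.DisjR2)
      moreover from \<delta> have "weight \<alpha> < weight \<delta>" by auto
      ultimately show ?thesis
        by (intro IH1) (simp_all add: \<Delta>)
    qed

    have dia_cost: "(3::nat) ^ weight \<phi> < 3 ^ weight (\<^bold>\<diamond> \<phi>)" for \<phi>
      by (rule p3) simp

    \<comment> \<open>Antecedents enter \<open>A\<close> only together with a separating world, as
      \<open>glue\<close> demands; \<open>A_imp\<close> brings in those that are implications. Both
      disjuncts of a succedent enter, since one root has to refute them simultaneously.\<close>
    define A where "A = {\<alpha>. (\<exists>\<chi>. \<alpha> \<^bold>\<rightarrow> \<chi> \<in># \<Gamma>) \<and> (\<exists>v. separates L v \<Gamma> {#\<alpha>#})} \<union>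
      {\<alpha>. \<exists>\<psi>. \<alpha> \<^bold>\<or> \<psi> \<in># \<Delta> \<or> \<psi> \<^bold>\<or> \<alpha> \<in># \<Delta>}"
    define B where "B = {\<beta>. (\<exists>\<chi>. \<^bold>\<box> \<beta> \<^bold>\<rightarrow> \<chi> \<in># \<Gamma>) \<or> \<^bold>\<box> \<beta> \<in># \<Delta>}"
    define D where "D = {\<delta>. (\<exists>\<chi>. \<^bold>\<diamond> \<delta> \<^bold>\<rightarrow> \<chi> \<in># \<Gamma>) \<or> \<^bold>\<diamond> \<delta> \<in># \<Delta>}"
    have B: "\<exists>u. separates L u (box_inv \<Gamma>) {#\<beta>#}" if "\<beta> \<in> B" for \<beta>
      using that unfolding B_def
    proof (elim CollectE disjE exE)
      fix \<chi>
      assume "\<^bold>\<box> \<beta> \<^bold>\<rightarrow> \<chi> \<in># \<Gamma>"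
      then obtain \<Gamma>' where \<Gamma>: "\<Gamma> = add_mset (\<^bold>\<box> \<beta> \<^bold>\<rightarrow> \<chi>) \<Gamma>'" by (metis multi_member_split)
      have "cost (box_inv \<Gamma>) + 3 ^ weight \<beta> < cost \<Gamma> + cost \<Delta>"
      proof -
        have "(3::nat) ^ weight \<beta> < 3 ^ weight (\<^bold>\<box> \<beta> \<^bold>\<rightarrow> \<chi>)" by (rule p3) simp
        with cost_box_inv[of \<Gamma>'] show ?thesis by (simp add: \<Gamma> del: weight.simps power_strict_increasing_iff)
      qed
      then show ?thesis
        using unprovable imp_keep[OF \<Gamma>] \<Gamma> by (intro IH1) (auto intro: G4.BoxImpL)
    next
      assume "\<^bold>\<box> \<beta> \<in># \<Delta>"
      then have \<Delta>: "\<Delta> = {#\<^bold>\<box> \<beta>#}" by (rule \<Delta>_cases)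
      have "cost (box_inv \<Gamma>) + 3 ^ weight \<beta> < cost \<Gamma> + cost \<Delta>"
        using cost_box_inv[of \<Gamma>] by (simp add: \<Delta> add_le_less_mono)
      then show ?thesis
        using unprovable by (intro IH1) (auto simp: \<Delta> intro: G4.BoxR)
    qed
    have D: "\<exists>u. separates L u (add_mset \<gamma> (box_inv \<Gamma>)) {#\<delta>#}" if "\<delta> \<in> D" "\<^bold>\<diamond> \<gamma> \<in># \<Gamma>" for \<delta> \<gamma>
      using that(1) unfolding D_def
    proof (elim CollectE disjE exE)
      fix \<chi>
      assume "\<^bold>\<diamond> \<delta> \<^bold>\<rightarrow> \<chi> \<in># \<Gamma>"
      with that(2) obtain \<Gamma>' where \<Gamma>: "\<Gamma> = add_mset (\<^bold>\<diamond> \<delta> \<^bold>\<rightarrow> \<chi>) (add_mset (\<^bold>\<diamond> \<gamma>) \<Gamma>')"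
        using two_members_split[of "\<^bold>\<diamond> \<delta> \<^bold>\<rightarrow> \<chi>" \<Gamma> "\<^bold>\<diamond> \<gamma>"] by auto
      have "cost (add_mset \<gamma> (box_inv \<Gamma>)) + 3 ^ weight \<delta> < cost \<Gamma> + cost \<Delta>"
      proof -
        have "(3::nat) ^ weight \<delta> < 3 ^ weight (\<^bold>\<diamond> \<delta> \<^bold>\<rightarrow> \<chi>)" by (rule p3) simp
        with cost_box_inv[of \<Gamma>'] dia_cost[of \<gamma>] show ?thesis by (simp add: \<Gamma> del: weight.simps power_strict_increasing_iff)
      qed
      then show ?thesis
        using unprovable imp_keep[OF \<Gamma>] \<Gamma> by (intro IH1) (auto intro: G4.DiaImpL)
    next
      assume "\<^bold>\<diamond> \<delta> \<in># \<Delta>"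
      then have \<Delta>: "\<Delta> = {#\<^bold>\<diamond> \<delta>#}" by (rule \<Delta>_cases)
      from that(2) obtain \<Gamma>' where \<Gamma>: "\<Gamma> = add_mset (\<^bold>\<diamond> \<gamma>) \<Gamma>'" by (metis multi_member_split)
      have "cost (add_mset \<gamma> (box_inv \<Gamma>)) + 3 ^ weight \<delta> < cost \<Gamma> + cost \<Delta>"
        using cost_box_inv[of \<Gamma>'] dia_cost[of \<delta>] dia_cost[of \<gamma>]
        by (simp add: \<Gamma> \<Delta> del: weight.simps power_strict_increasing_iff)
      \<comment> \<open>With a diamond as succedent, the premise of the WK rule coincides with that
        of the CK rule, so both logics fail on the same sequent.\<close>
      moreover have "dia_inv \<Delta> = {#\<delta>#}"
        by (simp add: \<Delta> dia_inv_def)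
      then have "\<not> G4 L (add_mset \<gamma> (box_inv \<Gamma>)) {#\<delta>#}"
        using unprovable G4.DiaL[of L \<gamma> \<Gamma>' \<delta>] G4.DiaL'[of L \<Delta> \<gamma> \<Gamma>'] \<open>succedent L \<Delta>\<close>
        by (cases L) (auto simp: \<Gamma> \<Delta>)
      ultimately show ?thesis by (rule IH1)
    qed
    \<comment> \<open>The failing premise of \<open>DiaL'\<close> has a countermodel; forgetting its
      succedent leaves a world that realises the diamond.\<close>
    have E: "\<exists>u. separates L u (add_mset \<gamma> (box_inv \<Gamma>)) {#}" if "L = WK" "\<^bold>\<diamond> \<gamma> \<in># \<Gamma>" for \<gamma>
    proof -
      from that(2) obtain \<Gamma>' where \<Gamma>: "\<Gamma> = add_mset (\<^bold>\<diamond> \<gamma>) \<Gamma>'" by (metis multi_member_split)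
      have "\<Delta> = {#} \<or> (\<exists>\<delta>. \<Delta> = {#\<delta>#})"
        using \<open>succedent L \<Delta>\<close> that(1) by (cases \<Delta>) auto
      then have "cost (dia_inv \<Delta>) \<le> cost \<Delta>" and "succedent L (dia_inv \<Delta>)"
        using that(1) by (auto simp: dia_inv_def is_Dia_def)
      moreover have "\<not> G4 L (add_mset \<gamma> (box_inv \<Gamma>)) (dia_inv \<Delta>)"
        using unprovable G4.DiaL'[of L \<Delta> \<gamma> \<Gamma>'] \<open>succedent L \<Delta>\<close> that(1) by (auto simp: \<Gamma>)
      moreover have "cost (add_mset \<gamma> (box_inv \<Gamma>)) < cost \<Gamma>"
        using cost_box_inv[of \<Gamma>'] dia_cost[of \<gamma>] by (simp add: \<Gamma> del: weight.simps power_strict_increasing_iff)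
      ultimately obtain u where "separates L u (add_mset \<gamma> (box_inv \<Gamma>)) (dia_inv \<Delta>)"
        using IH[of "add_mset \<gamma> (box_inv \<Gamma>)" "dia_inv \<Delta>"] by auto
      then show ?thesis by (auto simp: separates_def)
    qed
    have "finite A"
      using finite_antecedents[of \<Gamma>] finite_disjuncts[of \<Delta>] by (simp add: A_def)
    have "finite B"
      using finite_vimageI[OF finite_antecedents[of \<Gamma>], of Box]
        finite_vimageI[of "set_mset \<Delta>" Box] by (simp add: B_def inj_def vimage_def Collect_disj_eq)
    have "finite D"
      using finite_vimageI[OF finite_antecedents[of \<Gamma>], of Dia]
        finite_vimageI[of "set_mset \<Delta>" Dia] by (simp add: D_def inj_def vimage_def Collect_disj_eq)
    have A: "\<exists>v. separates L v \<Gamma> {#\<alpha>#}" if "\<alpha> \<in> A" for \<alpha>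
      using that A_disj by (auto simp: A_def)
    obtain r where fut: "\<And>v. future r v \<Longrightarrow> v = r \<or> separates L v \<Gamma> {#}"
      and var: "\<And>p. forces L r (Var p) \<longleftrightarrow> Var p \<in># \<Gamma>"
      and modal: "\<And>\<phi>. \<^bold>\<box> \<phi> \<in># \<Gamma> \<Longrightarrow> forces L r (\<^bold>\<box> \<phi>)" "\<And>\<phi>. \<^bold>\<diamond> \<phi> \<in># \<Gamma> \<Longrightarrow> forces L r (\<^bold>\<diamond> \<phi>)"
      and refuted: "\<And>\<alpha>. \<alpha> \<in> A \<Longrightarrow> \<not> forces L r \<alpha>"
        "\<And>\<beta>. \<beta> \<in> B \<Longrightarrow> \<not> forces L r (\<^bold>\<box> \<beta>)" "\<And>\<delta>. \<delta> \<in> D \<Longrightarrow> \<not> forces L r (\<^bold>\<diamond> \<delta>)"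
      using glue[OF \<open>finite A\<close> A \<open>finite B\<close> B \<open>finite D\<close> D E] by blast
    \<comment> \<open>This makes each implication in \<open>\<Gamma>\<close> hold vacuously at the
      root itself; at proper futures it holds because they force \<open>\<Gamma>\<close>.\<close>
    have antecedent: "\<not> forces L r \<alpha>" if "\<alpha> \<^bold>\<rightarrow> \<chi> \<in># \<Gamma>" for \<alpha> \<chi>
    proof (cases \<alpha>)
      case (Var p)
      with that noVarImp var show ?thesis by metis
    next
      case (Imp \<phi> \<psi>)
      with that have "\<alpha> \<in> A" by (auto simp: A_def dest: A_imp)
      then show ?thesis by (rule refuted)
    next
      case (Box \<beta>)
      with that have "\<beta> \<in> B" by (auto simp: B_def)
      with Box refuted show ?thesis by metis
    next
      case (Dia \<delta>)
      with that have "\<delta> \<in> D" by (auto simp: D_def)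
      with Dia refuted show ?thesis by metis
    qed (use that noConjImp noDisjImp in auto)
    have "forces L r \<gamma>" if "\<gamma> \<in># \<Gamma>" for \<gamma>
    proof (cases \<gamma>)
      case (Var p)
      with that var show ?thesis by metis
    next
      case (Imp \<alpha> \<chi>)
      have "forces L v \<chi>" if "future r v" "forces L v \<alpha>" for v
      proof -
        have "v \<noteq> r" using antecedent[of \<alpha> \<chi>] Imp \<open>\<gamma> \<in># \<Gamma>\<close> that(2) by blast
        with fut[OF that(1)] have "forces L v (\<alpha> \<^bold>\<rightarrow> \<chi>)"
          using Imp \<open>\<gamma> \<in># \<Gamma>\<close> by (auto simp: separates_def)
        with that(2) show ?thesis by simp
      qed
      with Imp show ?thesis by simp
    next
      case (Box \<phi>)
      with that modal show ?thesis by metis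
    next
      case (Dia \<phi>)
      with that modal show ?thesis by metis
    qed (use that noBot noConj noDisj in auto)
    moreover have "\<not> forces L r \<delta>" if "\<delta> \<in># \<Delta>" for \<delta>
    proof -
      have \<Delta>: "\<Delta> = {#\<delta>#}" using that by (rule \<Delta>_cases)
      show ?thesis
      proof (cases \<delta>)
        case (Var p)
        have "Var p \<notin># \<Gamma>"
          using unprovable G4.IdP by (metis \<Delta> Var multi_member_split)
        with Var var show ?thesis by metis
      next
        \<comment> \<open>A countermodel of either premise already refutes the conjunction,
          contradicting \<open>none\<close> without recourse to the root. Implication is treated
          likewise, through reflexivity of \<open>future\<close>.\<close>
        case (Conj \<phi> \<psi>)
        then have "\<not> G4 L \<Gamma> {#\<phi>#} \<or> \<not> G4 L \<Gamma> {#\<psi>#}"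
          using unprovable G4.ConjR \<Delta> by blast
        then obtain \<alpha> v where "\<alpha> \<in> {\<phi>, \<psi>}" "separates L v \<Gamma> {#\<alpha>#}"
          using IH1[of \<Gamma> \<phi>] IH1[of \<Gamma> \<psi>] Conj \<Delta> by auto
        then have "separates L v \<Gamma> \<Delta>"
          using Conj \<Delta> by (auto simp: separates_def)
        with none show ?thesis by blast
      next
        case (Disj \<phi> \<psi>)
        with that have "\<phi> \<in> A" "\<psi> \<in> A" by (auto simp: A_def)
        with Disj refuted show ?thesis by simp
      next
        case (Imp \<phi> \<psi>)
        then have "\<not> G4 L (add_mset \<phi> \<Gamma>) {#\<psi>#}"
          using unprovable G4.ImpR \<Delta> by blast
        then obtain v where "separates L v (add_mset \<phi> \<Gamma>) {#\<psi>#}"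
          using IH1[of "add_mset \<phi> \<Gamma>" \<psi>] p3(2)[of "weight \<phi>" "weight \<delta>" "weight \<psi>"] Imp \<Delta> by auto
        then have "separates L v \<Gamma> \<Delta>"
          using Imp \<Delta> by (auto simp: separates_def intro!: exI[of _ v])
        with none show ?thesis by blast
      next
        case (Box \<beta>)
        with that have "\<beta> \<in> B" by (auto simp: B_def)
        with Box refuted show ?thesis by metis
      next
        case (Dia \<delta>')
        with that have "\<delta>' \<in> D" by (auto simp: D_def)
        with Dia refuted show ?thesis by metis
      qed simp
    qed
    ultimately show False
      using none unfolding separates_def by blast
  qed
qed

section \<open>Equivalence of the sequent and Hilbert calculi\<close>

lemma G4_if_hilbert:
  assumes "hilbert (axioms_of L) (set_mset \<Gamma>) (succ_fm \<Delta>)" and "succedent L \<Delta>"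
  shows "G4 L \<Gamma> \<Delta>"
proof (rule ccontr)
  assume "\<not> G4 L \<Gamma> \<Delta>"
  then obtain w where w: "separates L w \<Gamma> \<Delta>"
    using countermodel assms(2) by blast
  with assms(1) have "forces L w (succ_fm \<Delta>)"
    by (auto simp: separates_def intro: hilbert_sound)
  moreover have "\<Delta> = {#} \<or> (\<exists>\<delta>. \<Delta> = {#\<delta>#})"
    using assms(2) by (cases L; cases \<Delta>) auto
  \<comment> \<open>An empty succedent is read as falsum, which no world forces.\<close>
  ultimately show False
    using w by (auto simp: separates_def)
qed

theorem theorem2:
  shows "(\<forall>(\<Gamma> :: fm multiset) (\<phi> :: fm). G4CK \<Gamma> {#\<phi>#} \<longleftrightarrow> CKH (set_mset \<Gamma>) \<phi>)
    \<and> (\<forall>(\<Gamma> :: fm multiset) (\<Delta> :: fm multiset).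
         size \<Delta> \<le> 1 \<longrightarrow> (G4WK \<Gamma> \<Delta> \<longleftrightarrow> WKH (set_mset \<Gamma>) (succ_fm \<Delta>)))"
proof (intro conjI allI impI)
  show "G4CK \<Gamma> {#\<phi>#} \<longleftrightarrow> CKH (set_mset \<Gamma>) \<phi>" for \<Gamma> \<phi>
    using hilbert_if_G4[of CK \<Gamma> "{#\<phi>#}"] G4_if_hilbert[of CK \<Gamma> "{#\<phi>#}"] by auto
  show "G4WK \<Gamma> \<Delta> \<longleftrightarrow> WKH (set_mset \<Gamma>) (succ_fm \<Delta>)" if "size \<Delta> \<le> 1" for \<Gamma> \<Delta>
    using hilbert_if_G4[of WK \<Gamma> \<Delta>] G4_if_hilbert[of WK \<Gamma> \<Delta>] that by auto
qed

end
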